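(* Let $H:\mathbb{T}^d\to\mathbb{R}^d$ be a $C^1$ vector field that is $\mathbb{T}^m$-equivariant, i.e. $H(\theta+R\phi)=H(\theta)$ for all $\theta\in\mathbb{T}^d$, $\phi\in\mathbb{T}^m$. Let $\theta_0\in\mathbb{T}^d$ and $\Omega\in\mathbb{R}^m$ satisfy $H(\theta_0)=R\Omega$, and let $E:\mathbb{T}^m\to\mathbb{T}^d$, $E(\phi)=\theta_0+R\phi$, be the embedding of the corresponding relative equilibrium. Assume that the invariant torus $E(\mathbb{T}^m)\subset\mathbb{T}^d$ is normally hyperbolic for $\dot\theta=H(\theta)$. Then there exist an injective linear map $N:\mathbb{R}^{d-m}\to\mathbb{R}^d$ and a hyperbolic linear map $L:\mathbb{R}^{d-m}\to\mathbb{R}^{d-m}$ such that: 1. $\mathbb{R}^d=\operatorname{im}R\oplus\operatorname{im}N$; 2. $DH(E(\phi))\,N=N\,L$ for all $\phi\in\mathbb{T}^m$.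
   Context: $\mathbb{T}=\mathbb{R}/2\pi\mathbb{Z}$. $R:\mathbb{R}^m\to\mathbb{R}^d$ is a linear map whose matrix has integer coefficients, so that it also induces a map $\mathbb{T}^m\to\mathbb{T}^d$ (again denoted $R$). The group $\mathbb{T}^m$ acts on $\mathbb{T}^d$ by $\theta\mapsto\theta+R\phi$, and this action is assumed to be free (so $R$ is injective). A linear map is hyperbolic if none of its (complex) eigenvalues lies on the imaginary axis. Normal hyperbolicity is meant in the standard sense: a compact invariant submanifold $M\subset\mathbb{T}^d$ of the flow $\Phi^t$ of $H$ is normally hyperbolic if there are a continuous splitting $T_p\mathbb{T}^d=T_pM\oplus E^s_p\oplus E^u_p$ ($p\in M$), invariant under $D\Phi^t$, and constants $C>0$, $0\le\mu<\lambda$ such that for all $p\in M$: $\|D\Phi^t(p)|_{E^s_p}\|\le Ce^{-\lambda t}$ for $t\ge0$, $\|D\Phi^{t}(p)|_{E^u_p}\|\le Ce^{\lambda t}$ for $t\le0$, and $\|D\Phi^t(p)|_{T_pM}\|\le Ce^{\mu|t|}$ for all $t\in\mathbb{R}$. Here $M=E(\mathbb{T}^m)$ and $T_pM=\operatorname{im}R$. *)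

theory Defs
  imports "HOL-Analysis.Analysis" "Jordan_Normal_Form.Char_Poly"
begin

text \<open>
  The ambient space \<open>\<real>\<^sup>d\<close> is \<open>real ^ 'd\<close>, with \<open>d = CARD('d)\<close>. The spaces \<open>\<real>\<^sup>k\<close> for \<open>k = m\<close> and
  \<open>k = d - m\<close>, whose dimension may be \<open>0\<close>, are \<open>carrier_vec k\<close>.

  Objects on \<open>\<T>\<^sup>d = \<real>\<^sup>d / (2\<pi>\<int>)\<^sup>d\<close> are given by their lifts to \<open>\<real>\<^sup>d\<close>: a point is represented by any of
  its preimages, a subset by its full preimage, and a function by a function that is compatible with
  the relation \<open>torus_eq\<close> below. Derivatives at points of the torus are derivatives of lifts,
  tangent spaces being identified with \<open>\<real>\<^sup>d\<close>.
\<close>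

no_notation Matrix.vec_index (infixl "$" 100)

definition torus_eq :: "real ^ 'd \<Rightarrow> real ^ 'd \<Rightarrow> bool" where
  "torus_eq x y \<longleftrightarrow> (\<forall>i. \<exists>n::int. x $ i - y $ i = 2 * pi * of_int n)"

definition torus_zero :: "real Matrix.vec \<Rightarrow> bool" where
  "torus_zero \<phi> \<longleftrightarrow> (\<forall>j<dim_vec \<phi>. \<exists>n::int. vec_index \<phi> j = 2 * pi * of_int n)"

text \<open>The linear map \<open>\<real>\<^sup>k \<rightarrow> \<real>\<^sup>d\<close> whose matrix has the columns \<open>a 0, \<dots>, a (k - 1)\<close>, and its image.\<close>

definition lin_map :: "(nat \<Rightarrow> real ^ 'd) \<Rightarrow> real Matrix.vec \<Rightarrow> real ^ 'd" where
  "lin_map a x = (\<Sum>j<dim_vec x. vec_index x j *\<^sub>R a j)"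

definition im_lin_map :: "nat \<Rightarrow> (nat \<Rightarrow> real ^ 'd) \<Rightarrow> (real ^ 'd) set" where
  "im_lin_map k a = lin_map a ` carrier_vec k"

definition free_torus_action :: "nat \<Rightarrow> (nat \<Rightarrow> real ^ 'd) \<Rightarrow> bool" where
  "free_torus_action m R \<longleftrightarrow>
     (\<forall>\<theta>. \<forall>\<phi> \<in> carrier_vec m. torus_eq (\<theta> + lin_map R \<phi>) \<theta> \<longrightarrow> torus_zero \<phi>)"

definition hyperbolic_mat :: "real mat \<Rightarrow> bool" where
  "hyperbolic_mat L \<longleftrightarrow> (\<forall>\<mu>. eigenvalue (map_mat complex_of_real L) \<mu> \<longrightarrow> Re \<mu> \<noteq> 0)"

definition direct_sum2 :: "'a::real_vector set \<Rightarrow> 'a set \<Rightarrow> bool" where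
  "direct_sum2 A B \<longleftrightarrow> subspace A \<and> subspace B \<and>
     (\<forall>v. \<exists>!(a, b). a \<in> A \<and> b \<in> B \<and> v = a + b)"

definition direct_sum3 :: "'a::real_vector set \<Rightarrow> 'a set \<Rightarrow> 'a set \<Rightarrow> bool" where
  "direct_sum3 A B C \<longleftrightarrow> subspace A \<and> subspace B \<and> subspace C \<and>
     (\<forall>v. \<exists>!(a, b, c). a \<in> A \<and> b \<in> B \<and> c \<in> C \<and> v = a + b + c)"

definition C1_field :: "(real ^ 'd \<Rightarrow> real ^ 'd) \<Rightarrow> bool" where
  "C1_field H \<longleftrightarrow> (\<exists>DH :: real ^ 'd \<Rightarrow> (real ^ 'd) \<Rightarrow>\<^sub>L (real ^ 'd).
     continuous_on UNIV DH \<and> (\<forall>x. (H has_derivative blinfun_apply (DH x)) (at x)))"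

definition is_flow :: "(real ^ 'd \<Rightarrow> real ^ 'd) \<Rightarrow> (real \<Rightarrow> real ^ 'd \<Rightarrow> real ^ 'd) \<Rightarrow> bool" where
  "is_flow H \<Phi> \<longleftrightarrow> (\<forall>x. \<Phi> 0 x = x \<and>
     (\<forall>t. ((\<lambda>s. \<Phi> s x) has_vector_derivative H (\<Phi> t x)) (at t)))"

text \<open>A continuous vector bundle over \<open>M\<close> inside the trivial bundle: near every point of \<open>M\<close> the
  fibres have a basis \<open>f 0, \<dots>, f (k - 1)\<close> consisting of continuous sections.\<close>

definition continuous_subbundle ::
    "(real ^ 'd) set \<Rightarrow> (real ^ 'd \<Rightarrow> (real ^ 'd) set) \<Rightarrow> bool" where
  "continuous_subbundle M E \<longleftrightarrow>
     (\<forall>p\<in>M. \<exists>U (k::nat) (f :: nat \<Rightarrow> real ^ 'd \<Rightarrow> real ^ 'd).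
        open U \<and> p \<in> U \<and> (\<forall>j<k. continuous_on (M \<inter> U) (f j)) \<and>
        (\<forall>q \<in> M \<inter> U. inj_on (\<lambda>j. f j q) {..<k} \<and>
           independent ((\<lambda>j. f j q) ` {..<k}) \<and> span ((\<lambda>j. f j q) ` {..<k}) = E q))"

definition invariant_bundle ::
    "(real \<Rightarrow> real ^ 'd \<Rightarrow> real ^ 'd) \<Rightarrow> (real ^ 'd) set \<Rightarrow> (real ^ 'd \<Rightarrow> (real ^ 'd) set) \<Rightarrow> bool" where
  "invariant_bundle \<Phi> M E \<longleftrightarrow>
     (\<forall>t. \<forall>p\<in>M. frechet_derivative (\<Phi> t) (at p) ` E p = E (\<Phi> t p))"

text \<open>
  Normal hyperbolicity of the compact submanifold of \<open>\<T>\<^sup>d\<close> with preimage \<open>M\<close> and tangent spaces \<open>TM p\<close>.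
  For a \<open>C\<^sup>1\<close> periodic field the flow \<open>\<Phi>\<close> exists, is unique and is of class \<open>C\<^sup>1\<close>,
  so the quantifier over \<open>\<Phi>\<close> only names it. The condition on \<open>torus_eq\<close> says that the fibres
  are attached to points of the torus. Continuity on \<open>M\<close> and on its image in \<open>\<T>\<^sup>d\<close> agree
  because \<open>\<real>\<^sup>d \<rightarrow> \<T>\<^sup>d\<close> is a covering.
  The constants \<open>\<mu> < \<nu>\<close> are the tangential and the normal rate.
\<close>

definition normally_hyperbolic ::
    "(real ^ 'd \<Rightarrow> real ^ 'd) \<Rightarrow> (real ^ 'd) set \<Rightarrow> (real ^ 'd \<Rightarrow> (real ^ 'd) set) \<Rightarrow> bool" where
  "normally_hyperbolic H M TM \<longleftrightarrow>
     (\<exists>\<Phi> Es Eu. \<exists>C \<mu> \<nu> :: real.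
        is_flow H \<Phi> \<and> (\<forall>t. \<forall>p\<in>M. \<Phi> t p \<in> M) \<and>
        (\<forall>p\<in>M. direct_sum3 (TM p) (Es p) (Eu p)) \<and>
        (\<forall>p\<in>M. \<forall>q\<in>M. torus_eq p q \<longrightarrow> Es p = Es q \<and> Eu p = Eu q) \<and>
        continuous_subbundle M Es \<and> continuous_subbundle M Eu \<and>
        invariant_bundle \<Phi> M TM \<and> invariant_bundle \<Phi> M Es \<and> invariant_bundle \<Phi> M Eu \<and>
        C > 0 \<and> 0 \<le> \<mu> \<and> \<mu> < \<nu> \<and>
        (\<forall>p\<in>M. \<forall>t\<ge>0. \<forall>v\<in>Es p.
           norm (frechet_derivative (\<Phi> t) (at p) v) \<le> C * exp (- \<nu> * t) * norm v) \<and>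
        (\<forall>p\<in>M. \<forall>t\<le>0. \<forall>v\<in>Eu p.
           norm (frechet_derivative (\<Phi> t) (at p) v) \<le> C * exp (\<nu> * t) * norm v) \<and>
        (\<forall>p\<in>M. \<forall>t. \<forall>v\<in>TM p.
           norm (frechet_derivative (\<Phi> t) (at p) v) \<le> C * exp (\<mu> * \<bar>t\<bar>) * norm v))"

text \<open>The relative equilibrium \<open>E(\<phi>) = \<theta>\<^sub>0 + R \<phi>\<close> and the preimage in \<open>\<real>\<^sup>d\<close> of \<open>E(\<T>\<^sup>m)\<close>.\<close>

definition rel_eq_emb :: "real ^ 'd \<Rightarrow> (nat \<Rightarrow> real ^ 'd) \<Rightarrow> real Matrix.vec \<Rightarrow> real ^ 'd" where
  "rel_eq_emb \<theta>\<^sub>0 R \<phi> = \<theta>\<^sub>0 + lin_map R \<phi>"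

definition rel_eq_torus :: "nat \<Rightarrow> real ^ 'd \<Rightarrow> (nat \<Rightarrow> real ^ 'd) \<Rightarrow> (real ^ 'd) set" where
  "rel_eq_torus m \<theta>\<^sub>0 R = {p. \<exists>\<phi> \<in> carrier_vec m. torus_eq p (rel_eq_emb \<theta>\<^sub>0 R \<phi>)}"

end

theory Submission
  imports Defs "HOL-Real_Asymp.Real_Asymp"
begin

text \<open>
  By equivariance \<open>DH\<close> equals one linear map \<open>A\<close> along the relative equilibrium, \<open>A\<close> vanishes on
  \<open>V = im R\<close>, and in the comoving frame the flow is that of an autonomous field with an
  equilibrium, so its derivative on the torus is \<open>exp (t A)\<close>. Normal hyperbolicity then forces every
  vector \<open>v\<close> with \<open>exp (t A) v\<close> of at most linear growth in both time directions into \<open>V\<close>. This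
  applies to \<open>A (A v) = 0\<close>, where \<open>exp (t A) v = v + t A v\<close>, and to real and imaginary parts of
  eigenvectors for imaginary eigenvalues. Hence \<open>ker A = V\<close> meets the range of \<open>A\<close> only in \<open>0\<close>, so
  the range is an invariant complement of \<open>V\<close>, and \<open>A\<close> is hyperbolic on it.
\<close>

section \<open>Gronwall estimates\<close>

text \<open>Working with the square of the norm avoids the point where the norm is not
  differentiable. The constant is far from sharp, but all later uses need only some bound for each
  fixed time. The term \<open>\<eta>\<close> makes room for a linearisation error.\<close>

lemma gronwall_quadratic:
  fixes z :: "real \<Rightarrow> 'a::real_inner"
  assumes der: "\<And>s. s \<in> {0..T} \<Longrightarrow> (z has_vector_derivative z' s) (at s)"
    and bd: "\<And>s. s \<in> {0..T} \<Longrightarrow> norm (z' s) \<le> a * norm (z s) + \<eta>"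
    and T: "0 \<le> T" and a: "0 \<le> a"
  shows "(norm (z T))\<^sup>2 + \<eta>\<^sup>2 \<le> exp ((2 * a + 1) * T) * ((norm (z 0))\<^sup>2 + \<eta>\<^sup>2)"
proof -
  \<comment> \<open>Adding \<open>\<eta>\<^sup>2\<close> absorbs the inhomogeneity, since \<open>2 \<bar>z\<bar> \<eta> \<le> \<bar>z\<bar>\<^sup>2 + \<eta>\<^sup>2\<close>.\<close>
  define f where "f s = (z s \<bullet> z s + \<eta>\<^sup>2) * exp (- ((2 * a + 1) * s))" for s
  have mono: "f T \<le> f 0"
  proof (rule DERIV_nonpos_imp_nonincreasing[OF T])
    fix s assume "0 \<le> s" "s \<le> T"
    then have s: "s \<in> {0..T}" by simp
    define D where "D = (2 * (z s \<bullet> z' s) - (2 * a + 1) * (z s \<bullet> z s + \<eta>\<^sup>2)) * exp (- ((2 * a + 1) * s))"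
    have "((\<lambda>s. z s \<bullet> z s) has_real_derivative 2 * (z s \<bullet> z' s)) (at s)"
      using has_derivative_inner[OF der[OF s, unfolded has_vector_derivative_def]
          der[OF s, unfolded has_vector_derivative_def]]
      by (rule has_derivative_imp_has_field_derivative) (simp add: inner_commute)
    then have "(f has_real_derivative D) (at s)"
      unfolding f_def D_def by (auto intro!: derivative_eq_intros simp: algebra_simps)
    moreover have "2 * (z s \<bullet> z' s) \<le> (2 * a + 1) * (z s \<bullet> z s + \<eta>\<^sup>2)"
    proof -
      have "2 * (z s \<bullet> z' s) \<le> 2 * (norm (z s) * (a * norm (z s) + \<eta>))"
        using norm_cauchy_schwarz[of "z s" "z' s"]
          mult_left_mono[OF bd[OF s] norm_ge_zero[of "z s"]] by linarith
      also have "\<dots> = 2 * a * (norm (z s))\<^sup>2 + 2 * norm (z s) * \<eta>"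
        by (simp add: power2_eq_square algebra_simps)
      also have "\<dots> \<le> (2 * a + 1) * (norm (z s))\<^sup>2 + \<eta>\<^sup>2"
        using sum_squares_bound[of "norm (z s)" \<eta>] by (simp add: algebra_simps)
      also have "\<dots> \<le> (2 * a + 1) * ((norm (z s))\<^sup>2 + \<eta>\<^sup>2)"
        using a by (simp add: algebra_simps)
      finally show ?thesis by (simp add: dot_square_norm)
    qed
    then have "D \<le> 0" unfolding D_def by (simp add: mult_le_0_iff)
    ultimately show "\<exists>y. (f has_real_derivative y) (at s) \<and> y \<le> 0" by blast
  qed
  have "(norm (z T))\<^sup>2 + \<eta>\<^sup>2 = f T * exp ((2 * a + 1) * T)"
    by (simp add: f_def dot_square_norm exp_minus)
  also have "\<dots> \<le> f 0 * exp ((2 * a + 1) * T)"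
    using mono by simp
  finally show ?thesis
    by (simp add: f_def dot_square_norm mult.commute)
qed

section \<open>The exponential of a linear map\<close>

text \<open>This is \<open>exp (t A) v\<close>. Taking \<open>A\<close> as a plain function lets
  \<open>lin_flow A t\<close> be compared directly with \<open>frechet_derivative\<close>.\<close>

definition lin_flow :: "('a \<Rightarrow> 'a) \<Rightarrow> real \<Rightarrow> 'a \<Rightarrow> 'a::real_normed_vector" where
  "lin_flow A t v = (\<Sum>n. (t ^ n / fact n) *\<^sub>R (A ^^ n) v)"

lemma lin_flow_sums:
  fixes A :: "'a::banach \<Rightarrow> 'a"
  assumes "bounded_linear A"
  shows "(\<lambda>n. (t ^ n / fact n) *\<^sub>R (A ^^ n) v) sums lin_flow A t v"
proof -
  obtain K where K: "K \<ge> 0" "\<And>x. norm (A x) \<le> K * norm x"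
    using bounded_linear.nonneg_bounded[OF assms] by (metis mult.commute)
  have pow: "norm ((A ^^ n) v) \<le> K ^ n * norm v" for n
  proof (induction n)
    case (Suc n)
    then show ?case
      using K(2)[of "(A ^^ n) v"] mult_left_mono[OF Suc K(1)] by (simp add: mult.assoc)
  qed simp
  have "summable (\<lambda>n. inverse (fact n) * (\<bar>t\<bar> * K) ^ n * norm v)"
    by (intro summable_mult2 summable_exp)
  then have "summable (\<lambda>n. (t ^ n / fact n) *\<^sub>R (A ^^ n) v)"
  proof (rule summable_comparison_test'[where N = 0])
    fix n :: nat show "norm ((t ^ n / fact n) *\<^sub>R (A ^^ n) v) \<le> inverse (fact n) * (\<bar>t\<bar> * K) ^ n * norm v"
      using mult_left_mono[OF pow[of n], of "\<bar>t\<bar> ^ n / fact n"]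
      by (simp add: power_abs power_mult_distrib field_simps)
  qed
  then show ?thesis unfolding lin_flow_def by (rule summable_sums)
qed

lemma lin_flow_0 [simp]:
  assumes "bounded_linear (A :: 'a::banach \<Rightarrow> 'a)"
  shows "lin_flow A 0 v = v"
proof -
  have "(\<lambda>n. (0 ^ n / fact n) *\<^sub>R (A ^^ n) v) = (\<lambda>n. if n = 0 then v else 0)"
    by auto
  then have "(\<lambda>n. if n = 0 then v else 0) sums lin_flow A 0 v"
    using lin_flow_sums[OF assms, of 0 v] by simp
  moreover have "(\<lambda>n. if n = 0 then v else 0) sums v"
    using sums_If_finite_set[of "{0::nat}" "\<lambda>_. v"] by simp
  ultimately show ?thesis by (rule sums_unique2)
qed

text \<open>Each coordinate of \<open>lin_flow A t v\<close> is a scalar power series in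
  \<open>t\<close> that converges everywhere, so it can be differentiated term by term. In
  \<open>diffs\<close> the factor \<open>n + 1\<close> cancels against the factorial, and one more
  application of \<open>A\<close> appears.\<close>

lemma has_vector_derivative_lin_flow:
  fixes A :: "'a::euclidean_space \<Rightarrow> 'a"
  assumes A: "bounded_linear A"
  shows "((\<lambda>t. lin_flow A t v) has_vector_derivative A (lin_flow A t v)) (at t)"
  unfolding has_vector_derivative_def
proof (subst has_derivative_componentwise_within, intro ballI)
  fix i :: 'a
  define c where "c n = ((A ^^ n) v \<bullet> i) / fact n" for n
  have sums: "(\<lambda>n. c n * s ^ n) sums (lin_flow A s v \<bullet> i)" for s
    using bounded_linear.sums[OF bounded_linear_inner_left lin_flow_sums[OF A, of s v], of i]
    by (simp add: c_def field_simps)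
  have "((\<lambda>s. \<Sum>n. c n * s ^ n) has_real_derivative (\<Sum>n. diffs c n * t ^ n)) (at t)"
    using sums by (intro termdiffs_strong_converges_everywhere) (auto simp: sums_iff)
  moreover have "(\<lambda>s. \<Sum>n. c n * s ^ n) = (\<lambda>s. lin_flow A s v \<bullet> i)"
    using sums by (auto simp: sums_iff)
  moreover have "diffs c n * t ^ n = A ((t ^ n / fact n) *\<^sub>R (A ^^ n) v) \<bullet> i" for n
    by (simp add: diffs_def c_def linear_cmul[OF bounded_linear.linear[OF A]] field_simps
        del: of_nat_Suc)
  then have "(\<lambda>n. diffs c n * t ^ n) sums (A (lin_flow A t v) \<bullet> i)"
    using bounded_linear.sums[OF bounded_linear_inner_left
        bounded_linear.sums[OF A lin_flow_sums[OF A, of t v]], of i]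
    by simp
  ultimately have "((\<lambda>s. lin_flow A s v \<bullet> i) has_real_derivative A (lin_flow A t v) \<bullet> i) (at t)"
    by (simp add: sums_iff)
  then show "((\<lambda>x. lin_flow A x v \<bullet> i) has_derivative (\<lambda>x. x *\<^sub>R A (lin_flow A t v) \<bullet> i)) (at t)"
    unfolding has_field_derivative_def by (simp add: mult.commute[of _ "A _ \<bullet> i"])
qed

text \<open>The substitution \<open>s \<mapsto> sgn t * s\<close> turns both signs of
  \<open>t\<close> into the forward estimate on \<open>{0..\<bar>t\<bar>}\<close>. Backward time is
  essential later, since the stable component of a vector is detected there.\<close>

lemma gronwall_two_sided:
  fixes z :: "real \<Rightarrow> 'a::real_inner"
  assumes der: "\<And>s. (z has_vector_derivative z' s) (at s)"
    and bd: "\<And>s. \<bar>s\<bar> \<le> \<bar>t\<bar> \<Longrightarrow> norm (z' s) \<le> a * norm (z s) + \<eta>"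
    and a: "0 \<le> a"
  shows "(norm (z t))\<^sup>2 + \<eta>\<^sup>2 \<le> exp ((2 * a + 1) * \<bar>t\<bar>) * ((norm (z 0))\<^sup>2 + \<eta>\<^sup>2)"
proof -
  have "(norm (z (sgn t * \<bar>t\<bar>)))\<^sup>2 + \<eta>\<^sup>2
      \<le> exp ((2 * a + 1) * \<bar>t\<bar>) * ((norm (z (sgn t * 0)))\<^sup>2 + \<eta>\<^sup>2)"
  proof (rule gronwall_quadratic[where z' = "\<lambda>s. sgn t *\<^sub>R z' (sgn t * s)"])
    fix s assume "s \<in> {0..\<bar>t\<bar>}"
    have "((*) (sgn t) has_vector_derivative sgn t) (at s)"
      by (auto intro!: derivative_eq_intros)
    from vector_diff_chain_at[OF this der]
    show "((\<lambda>s. z (sgn t * s)) has_vector_derivative sgn t *\<^sub>R z' (sgn t * s)) (at s)"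
      by (simp add: o_def)
  next
    fix s assume "s \<in> {0..\<bar>t\<bar>}"
    then have "\<bar>sgn t * s\<bar> \<le> \<bar>t\<bar>" by (auto simp: abs_mult sgn_if)
    \<comment> \<open>For \<open>t = 0\<close> the left side is \<open>0\<close>, and what remains
      is that the right side is nonnegative; this follows from \<open>bd\<close>, whose left side is
      a norm.\<close>
    from bd[OF this] show "norm (sgn t *\<^sub>R z' (sgn t * s)) \<le> a * norm (z (sgn t * s)) + \<eta>"
      using order_trans[OF norm_ge_zero bd[OF \<open>\<bar>sgn t * s\<bar> \<le> \<bar>t\<bar>\<close>]]
      by (cases "t = 0") (auto simp: sgn_if)
  qed (use a in auto)
  then show ?thesis by (simp add: mult.commute abs_mult_sgn)
qed

text \<open>The difference of two solutions solves the same linear equation and starts at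
  \<open>0\<close>, so Gronwall with \<open>\<eta> = 0\<close> makes it vanish. The group law,
  linearity in \<open>v\<close> and the explicit formulas below all follow by exhibiting a solution
  with the right initial value.\<close>

lemma lin_flow_unique:
  fixes A :: "'a::euclidean_space \<Rightarrow> 'a"
  assumes A: "bounded_linear A"
    and u: "\<And>s. (u has_vector_derivative A (u s)) (at s)"
  shows "u t = lin_flow A t (u 0)"
proof -
  obtain K where K: "K \<ge> 0" "\<And>x. norm (A x) \<le> K * norm x"
    using bounded_linear.nonneg_bounded[OF A] by (metis mult.commute)
  interpret A: bounded_linear A by (rule A)
  define z where "z s = u s - lin_flow A s (u 0)" for s
  have der: "(z has_vector_derivative A (z s)) (at s)" for s
    unfolding z_def A.diff by (intro has_vector_derivative_diff u has_vector_derivative_lin_flow A)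
  have "(norm (z t))\<^sup>2 + 0\<^sup>2 \<le> exp ((2 * K + 1) * \<bar>t\<bar>) * ((norm (z 0))\<^sup>2 + 0\<^sup>2)"
    by (rule gronwall_two_sided[OF der]) (use K in auto)
  then show ?thesis by (simp add: z_def A)
qed

lemma lin_flow_add:
  fixes A :: "'a::euclidean_space \<Rightarrow> 'a"
  assumes A: "bounded_linear A"
  shows "lin_flow A (s + t) v = lin_flow A s (lin_flow A t v)"
proof -
  have "((\<lambda>s. lin_flow A (s + t) v) has_vector_derivative A (lin_flow A (s + t) v)) (at s)" for s
  proof -
    have "((\<lambda>s. s + t) has_vector_derivative 1) (at s)"
      by (auto intro!: derivative_eq_intros)
    from vector_diff_chain_at[OF this has_vector_derivative_lin_flow[OF A]]
    show ?thesis by (simp add: o_def)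
  qed
  from lin_flow_unique[OF A this, of s] show ?thesis by simp
qed

lemma lin_flow_minus:
  fixes A :: "'a::euclidean_space \<Rightarrow> 'a"
  assumes "bounded_linear A"
  shows "lin_flow A (- t) (lin_flow A t v) = v"
  using lin_flow_add[OF assms, of "- t" t v] assms by simp

lemma bounded_linear_lin_flow:
  fixes A :: "'a::euclidean_space \<Rightarrow> 'a"
  assumes A: "bounded_linear A"
  shows "bounded_linear (lin_flow A t)"
proof -
  interpret A: bounded_linear A by (rule A)
  note der = has_vector_derivative_lin_flow[OF A]
  have "linear (lin_flow A t)"
  proof
    fix v w
    have "((\<lambda>t. lin_flow A t v + lin_flow A t w) has_vector_derivative
        A (lin_flow A s v + lin_flow A s w)) (at s)" for s
      unfolding A.add by (intro has_vector_derivative_add der)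
    from lin_flow_unique[OF A this, of t]
    show "lin_flow A t (v + w) = lin_flow A t v + lin_flow A t w" using A by simp
  next
    fix r v
    have "((\<lambda>t. r *\<^sub>R lin_flow A t v) has_vector_derivative A (r *\<^sub>R lin_flow A s v)) (at s)" for s
      unfolding A.scaleR
      by (rule bounded_linear.has_vector_derivative[OF bounded_linear_scaleR_right der])
    from lin_flow_unique[OF A this, of t]
    show "lin_flow A t (r *\<^sub>R v) = r *\<^sub>R lin_flow A t v" using A by simp
  qed
  then show ?thesis by (simp add: linear_conv_bounded_linear)
qed

lemma lin_flow_kernel:
  fixes A :: "'a::euclidean_space \<Rightarrow> 'a"
  assumes A: "bounded_linear A" and "A v = 0"
  shows "lin_flow A t v = v"
  using lin_flow_unique[OF A, of "\<lambda>_. v" t] assms by simp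

text \<open>The exponential series stops after its linear term. A nilpotent part of \<open>A\<close>
  thus shows up as linear growth, which is slower than every exponential rate.\<close>

lemma lin_flow_kernel_square:
  fixes A :: "'a::euclidean_space \<Rightarrow> 'a"
  assumes A: "bounded_linear A" and "A (A v) = 0"
  shows "lin_flow A t v = v + t *\<^sub>R A v"
proof -
  interpret A: bounded_linear A by (rule A)
  have "((\<lambda>t. v + t *\<^sub>R A v) has_vector_derivative A (v + s *\<^sub>R A v)) (at s)" for s
    using assms(2) by (auto intro!: derivative_eq_intros simp: A.add A.scaleR)
  from lin_flow_unique[OF A this, of t] show ?thesis by simp
qed

text \<open>Here \<open>v\<close> and \<open>w\<close> are the real and imaginary parts of an
  eigenvector for the eigenvalue \<open>i \<omega>\<close>; the resulting orbit is bounded. The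
  value \<open>\<omega> = 0\<close> is allowed.\<close>

lemma lin_flow_rotation:
  fixes A :: "'a::euclidean_space \<Rightarrow> 'a"
  assumes A: "bounded_linear A" and v: "A v = - (\<omega> *\<^sub>R w)" and w: "A w = \<omega> *\<^sub>R v"
  shows "lin_flow A t v = cos (\<omega> * t) *\<^sub>R v - sin (\<omega> * t) *\<^sub>R w"
proof -
  interpret A: bounded_linear A by (rule A)
  have "((\<lambda>t. cos (\<omega> * t) *\<^sub>R v - sin (\<omega> * t) *\<^sub>R w) has_vector_derivative
      A (cos (\<omega> * s) *\<^sub>R v - sin (\<omega> * s) *\<^sub>R w)) (at s)" for s
    by (auto intro!: derivative_eq_intros simp: A.diff A.scaleR v w has_real_derivative_iff_has_vector_derivative[symmetric] algebra_simps)
  from lin_flow_unique[OF A this, of t] show ?thesis by simp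
qed

section \<open>The linearised flow along a relative equilibrium\<close>

text \<open>Within the radius \<open>d\<close> where the linearisation error has slope at most
  \<open>1\<close>, the slope \<open>a + 1\<close> suffices; outside it,
  \<open>norm w \<ge> d\<close> absorbs the constant bound \<open>2 * B\<close>. Being global in
  \<open>w\<close>, the estimate can enter Gronwall before anything is known about where a solution
  stays.\<close>

lemma bounded_differentiable_at_imp_linear_growth:
  fixes H :: "'a::real_normed_vector \<Rightarrow> 'b::real_normed_vector"
  assumes der: "(H has_derivative A) (at p)" and B: "\<And>x. norm (H x) \<le> B"
  obtains K where "0 \<le> K" "\<And>w. norm (H (p + w) - H p) \<le> K * norm w"
proof -
  have A: "bounded_linear A" using der by (rule has_derivative_bounded_linear)
  obtain a where a: "a \<ge> 0" "\<And>x. norm (A x) \<le> a * norm x"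
    using bounded_linear.nonneg_bounded[OF A] by (metis mult.commute)
  obtain d where d: "d > 0"
    "\<And>y. norm (y - p) < d \<Longrightarrow> norm (H y - H p - A (y - p)) \<le> 1 * norm (y - p)"
    using conjunct2[OF der[unfolded has_derivative_at_alt], rule_format, of 1] by auto
  have B0: "0 \<le> B" using B[of p] norm_ge_zero order_trans by blast
  have "norm (H (p + w) - H p) \<le> (a + 1 + 2 * B / d) * norm w" for w
  proof (cases "norm w < d")
    case True
    have "norm (H (p + w) - H p) \<le> norm (H (p + w) - H p - A w) + norm (A w)"
      using norm_triangle_ineq[of "H (p + w) - H p - A w" "A w"] by simp
    also have "\<dots> \<le> norm w + a * norm w" using d(2)[of "p + w"] True a(2)[of w] by simp
    also have "\<dots> \<le> (a + 1 + 2 * B / d) * norm w"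
      using B0 d(1) by (simp add: algebra_simps)
    finally show ?thesis .
  next
    case False
    have "norm (H (p + w) - H p) \<le> 2 * B"
      using norm_triangle_ineq4[of "H (p + w)" "H p"] B[of "p + w"] B[of p] by linarith
    also have "\<dots> \<le> 2 * B / d * norm w"
      using False d(1) B0 mult_left_mono[of d "norm w" "2 * B"] by (simp add: field_simps)
    also have "\<dots> \<le> (a + 1 + 2 * B / d) * norm w"
      using a(1) by (simp add: algebra_simps)
    finally show ?thesis .
  qed
  moreover have "0 \<le> a + 1 + 2 * B / d" using a(1) B0 d(1) by simp
  ultimately show ?thesis using that by blast
qed

text \<open>Gronwall is applied twice. First it bounds the displacement \<open>w\<close> by a
  multiple of \<open>norm (y - p)\<close> for all times up to \<open>t\<close>. Then it compares
  \<open>w\<close> with the linear flow, the linearisation error of \<open>H\<close> at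
  \<open>p\<close> along \<open>w\<close> being the inhomogeneity.\<close>

lemma flow_relative_equilibrium:
  fixes H :: "'a::euclidean_space \<Rightarrow> 'a"
  assumes der: "(H has_derivative A) (at p)" and B: "\<And>x. norm (H x) \<le> B"
    and shift: "\<And>s x. H (x + s *\<^sub>R H p) = H x"
    and flow0: "\<And>x. \<Phi> 0 x = x"
    and flow: "\<And>t x. ((\<lambda>s. \<Phi> s x) has_vector_derivative H (\<Phi> t x)) (at t)"
  shows "\<Phi> t p = p + t *\<^sub>R H p" and "(\<Phi> t has_derivative lin_flow A t) (at p)"
proof -
  have A: "bounded_linear A" using der by (rule has_derivative_bounded_linear)
  interpret A: bounded_linear A by (rule A)
  obtain a where a: "a \<ge> 0" "\<And>x. norm (A x) \<le> a * norm x"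
    using bounded_linear.nonneg_bounded[OF A] by (metis mult.commute)
  obtain K where K: "0 \<le> K" "\<And>w. norm (H (p + w) - H p) \<le> K * norm w"
    using bounded_differentiable_at_imp_linear_growth[OF der B] by metis
  \<comment> \<open>In the comoving frame \<open>p\<close> is an equilibrium of the autonomous field \<open>w \<mapsto> H (p + w) - H p\<close>.\<close>
  define w where "w y s = \<Phi> s y - p - s *\<^sub>R H p" for y s
  have H_eq: "H (\<Phi> s y) = H (p + w y s)" for s y
    using shift[of "p + w y s" s] by (simp add: w_def)
  have w0: "w y 0 = y - p" for y by (simp add: w_def flow0)
  have w_der: "(w y has_vector_derivative H (p + w y s) - H p) (at s)" for y s
  proof -
    have "((\<lambda>s. s *\<^sub>R H p) has_vector_derivative H p) (at s)"
      by (auto intro!: derivative_eq_intros)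
    then have "((\<lambda>s. \<Phi> s y - p - s *\<^sub>R H p) has_vector_derivative H (\<Phi> s y) - 0 - H p) (at s)"
      by (intro has_vector_derivative_diff flow has_vector_derivative_const)
    moreover have "w y = (\<lambda>s. \<Phi> s y - p - s *\<^sub>R H p)" by (simp add: w_def fun_eq_iff)
    ultimately show ?thesis by (simp add: H_eq)
  qed
  \<comment> \<open>The Gronwall factor for squared norms, hence the square roots below.\<close>
  define Q where "Q = exp ((2 * K + 1) * \<bar>t\<bar>)"
  have w_bd: "norm (w y s) \<le> sqrt Q * norm (y - p)" if "\<bar>s\<bar> \<le> \<bar>t\<bar>" for y s
  proof -
    have "(norm (w y s))\<^sup>2 + 0\<^sup>2 \<le> exp ((2 * K + 1) * \<bar>s\<bar>) * ((norm (w y 0))\<^sup>2 + 0\<^sup>2)"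
      by (rule gronwall_two_sided[OF w_der]) (use K in auto)
    also have "\<dots> \<le> Q * (norm (y - p))\<^sup>2"
      unfolding Q_def w0 using that K(1) by (auto intro!: mult_right_mono mult_left_mono)
    finally show ?thesis
      using real_le_rsqrt real_sqrt_mult by fastforce
  qed
  \<comment> \<open>For the starting point \<open>y = p\<close> the bound on \<open>w\<close> is
    \<open>0\<close>.\<close>
  show eq: "\<Phi> t p = p + t *\<^sub>R H p"
    using w_bd[of t p] by (simp add: w_def algebra_simps)
  define Q2 where "Q2 = exp ((2 * a + 1) * \<bar>t\<bar>)"
  have Q: "Q > 0" "Q2 > 0" by (simp_all add: Q_def Q2_def)
  show "(\<Phi> t has_derivative lin_flow A t) (at p)"
    unfolding has_derivative_at_alt
  proof (intro conjI allI impI bounded_linear_lin_flow A)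
    fix e :: real assume e: "e > 0"
    \<comment> \<open>Chosen to compensate both Gronwall factors:
      \<open>sqrt Q2 * (\<epsilon> * sqrt Q) = e\<close>.\<close>
    define \<epsilon> where "\<epsilon> = e / (sqrt Q2 * sqrt Q)"
    have "\<epsilon> > 0" using e Q by (simp add: \<epsilon>_def)
    then obtain d where d: "d > 0"
      "\<And>y. norm (y - p) < d \<Longrightarrow> norm (H y - H p - A (y - p)) \<le> \<epsilon> * norm (y - p)"
      using conjunct2[OF der[unfolded has_derivative_at_alt], rule_format, of \<epsilon>] by auto
    have "norm (\<Phi> t y - \<Phi> t p - lin_flow A t (y - p)) \<le> e * norm (y - p)"
      \<comment> \<open>This radius keeps the displacement below \<open>d\<close> during the whole
        time interval, so the linearisation estimate applies at every \<open>s\<close>.\<close>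
      if y: "norm (y - p) < d / sqrt Q" for y
    proof -
      define z where "z s = w y s - lin_flow A s (y - p)" for s
      define \<eta> where "\<eta> = \<epsilon> * sqrt Q * norm (y - p)"
      have \<eta>: "\<eta> \<ge> 0" using \<open>\<epsilon> > 0\<close> Q by (simp add: \<eta>_def)
      have z_der: "(z has_vector_derivative
          A (z s) + (H (p + w y s) - H p - A (w y s))) (at s)" for s
        unfolding z_def[abs_def] A.diff
        by (rule has_vector_derivative_eq_rhs[OF has_vector_derivative_diff[OF w_der
                has_vector_derivative_lin_flow[OF A]]]) simp
      have "(norm (z t))\<^sup>2 + \<eta>\<^sup>2 \<le> Q2 * ((norm (z 0))\<^sup>2 + \<eta>\<^sup>2)"
        unfolding Q2_def
      proof (rule gronwall_two_sided[OF z_der _ a(1)])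
        fix s assume s: "\<bar>s\<bar> \<le> \<bar>t\<bar>"
        have "sqrt Q * norm (y - p) < d" using y Q by (simp add: field_simps)
        then have "norm (w y s) < d" using w_bd[OF s, of y] by linarith
        then have "norm (H (p + w y s) - H p - A (w y s)) \<le> \<epsilon> * norm (w y s)"
          using d(2)[of "p + w y s"] by simp
        also have "\<dots> \<le> \<eta>"
          using mult_left_mono[OF w_bd[OF s, of y], of \<epsilon>] \<open>\<epsilon> > 0\<close> by (simp add: \<eta>_def)
        finally show "norm (A (z s) + (H (p + w y s) - H p - A (w y s))) \<le> a * norm (z s) + \<eta>"
          using norm_triangle_le add_mono[OF a(2)[of "z s"]] by blast
      qed
      \<comment> \<open>The initial value \<open>z 0\<close> vanishes, and the square of
        \<open>\<eta>\<close> on the left is dropped.\<close>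
      then have "(norm (z t))\<^sup>2 \<le> Q2 * \<eta>\<^sup>2"
        by (simp add: z_def w0 A) (smt (verit) zero_le_power2)
      then have "norm (z t) \<le> sqrt Q2 * \<eta>"
        using \<eta> real_le_rsqrt[of "norm (z t)" "Q2 * \<eta>\<^sup>2"] by (simp add: real_sqrt_mult)
      also have "\<dots> = e * norm (y - p)"
        using Q by (simp add: \<eta>_def \<epsilon>_def)
      also have "z t = \<Phi> t y - \<Phi> t p - lin_flow A t (y - p)"
        by (simp add: z_def w_def eq algebra_simps)
      finally show ?thesis .
    qed
    then show "\<exists>d>0. \<forall>y. norm (y - p) < d \<longrightarrow>
        norm (\<Phi> t y - \<Phi> t p - lin_flow A t (y - p)) \<le> e * norm (y - p)"
      using d(1) Q(1) by (intro exI[of _ "d / sqrt Q"]) simp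
  qed
qed

section \<open>Linear maps given by their columns\<close>

lemma lin_map_smult:
  "lin_map a (c \<cdot>\<^sub>v x) = c *\<^sub>R lin_map a x"
  by (simp add: lin_map_def scaleR_sum_right)

lemma lin_map_minus:
  assumes "x \<in> carrier_vec k" "y \<in> carrier_vec k"
  shows "lin_map a (x - y) = lin_map a x - lin_map a y"
  using assms by (simp add: lin_map_def sum_subtractf[symmetric] scaleR_diff_left)

lemma im_lin_map_eq_span: "im_lin_map k a = span (a ` {..<k})"
proof
  show "im_lin_map k a \<subseteq> span (a ` {..<k})"
  proof
    fix v assume "v \<in> im_lin_map k a"
    then obtain x where x: "x \<in> carrier_vec k" "v = (\<Sum>j<k. vec_index x j *\<^sub>R a j)"
      unfolding im_lin_map_def lin_map_def by auto
    show "v \<in> span (a ` {..<k})"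
      unfolding x(2) by (rule span_sum, rule span_scale, rule span_base, rule imageI)
  qed
  have lin: "subspace (im_lin_map k a)"
    unfolding subspace_def
  proof (intro conjI ballI allI)
    have "lin_map a (0\<^sub>v k) = 0" by (simp add: lin_map_def)
    then show "0 \<in> im_lin_map k a" unfolding im_lin_map_def by force
  next
    fix u v assume "u \<in> im_lin_map k a" "v \<in> im_lin_map k a"
    then obtain x y where xy: "x \<in> carrier_vec k" "y \<in> carrier_vec k"
      "u = lin_map a x" "v = lin_map a y" unfolding im_lin_map_def by blast
    then have "u + v = lin_map a (x + y)"
      by (simp add: lin_map_def sum.distrib[symmetric] scaleR_add_left)
    moreover have "x + y \<in> carrier_vec k" using xy by simp
    ultimately show "u + v \<in> im_lin_map k a" unfolding im_lin_map_def by (rule image_eqI)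
  next
    fix c u assume "u \<in> im_lin_map k a"
    then obtain x where "x \<in> carrier_vec k" "u = lin_map a x" unfolding im_lin_map_def by blast
    then have "c *\<^sub>R u = lin_map a (c \<cdot>\<^sub>v x)" "c \<cdot>\<^sub>v x \<in> carrier_vec k"
      by (simp_all add: lin_map_smult)
    then show "c *\<^sub>R u \<in> im_lin_map k a" unfolding im_lin_map_def by (rule image_eqI)
  qed
  show "span (a ` {..<k}) \<subseteq> im_lin_map k a"
  proof (rule span_minimal[OF _ lin], clarify)
    fix j assume j: "j < k"
    have "lin_map a (unit_vec k j) = (\<Sum>i<k. if i = j then a j else 0)"
      unfolding lin_map_def using j by (intro sum.cong) auto
    also have "\<dots> = a j" using j by simp
    finally show "a j \<in> im_lin_map k a" unfolding im_lin_map_def by (metis imageI unit_vec_carrier)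
  qed
qed

lemma inj_on_lin_map_iff:
  "inj_on (lin_map a) (carrier_vec k) \<longleftrightarrow> (\<forall>x \<in> carrier_vec k. lin_map a x = 0 \<longrightarrow> x = 0\<^sub>v k)"
proof
  have "lin_map a (0\<^sub>v k) = 0" by (simp add: lin_map_def)
  then show "inj_on (lin_map a) (carrier_vec k) \<Longrightarrow>
      \<forall>x \<in> carrier_vec k. lin_map a x = 0 \<longrightarrow> x = 0\<^sub>v k"
    by (metis inj_onD zero_carrier_vec)
next
  assume inj: "\<forall>x \<in> carrier_vec k. lin_map a x = 0 \<longrightarrow> x = 0\<^sub>v k"
  show "inj_on (lin_map a) (carrier_vec k)"
  proof (rule inj_onI)
    fix x y :: "real Matrix.vec"
    assume xy: "x \<in> carrier_vec k" "y \<in> carrier_vec k" "lin_map a x = lin_map a y"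
    then have "x - y = 0\<^sub>v k" using inj by (simp add: lin_map_minus)
    then have "vec_index (x - y) i = 0" if "i < k" for i
      using that by simp
    then have "vec_index x i = vec_index y i" if "i < k" for i
      using that xy by simp
    then show "x = y" using xy by (intro eq_vecI) auto
  qed
qed

text \<open>\<open>independent\<close> speaks of the set of columns and would not notice a repeated
  column; the conjunct \<open>inj_on a {..<k}\<close> excludes repetitions.\<close>

lemma inj_on_lin_map_iff_independent:
  "inj_on (lin_map a) (carrier_vec k) \<longleftrightarrow> inj_on a {..<k} \<and> independent (a ` {..<k})"
proof
  assume inj: "inj_on (lin_map a) (carrier_vec k)"
  have zero: "c j = 0" if "(\<Sum>j<k. c j *\<^sub>R a j) = 0" "j < k" for c j
  proof -
    have "lin_map a (Matrix.vec k c) = 0" using that(1) by (simp add: lin_map_def)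
    then have "Matrix.vec k c = 0\<^sub>v k" using inj unfolding inj_on_lin_map_iff by simp
    then show ?thesis using that(2) by (metis index_vec index_zero_vec(1))
  qed
  have inj_a: "inj_on a {..<k}"
  proof (rule inj_onI, rule ccontr)
    fix i j assume ij: "i \<in> {..<k}" "j \<in> {..<k}" "a i = a j" "i \<noteq> j"
    \<comment> \<open>The difference of two unit vectors, which a repeated column would put into the
      kernel.\<close>
    define c :: "nat \<Rightarrow> real" where "c l = (if l = i then 1 else 0) - (if l = j then 1 else 0)" for l
    have "(\<Sum>l<k. c l *\<^sub>R a l)
        = (\<Sum>l<k. if l = i then a l else 0) - (\<Sum>l<k. if l = j then a l else 0)"
      unfolding sum_subtractf[symmetric] by (intro sum.cong) (auto simp: c_def)
    also have "\<dots> = 0" using ij by simp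
    finally have "c i = 0" using zero ij by blast
    then show False using ij by (simp add: c_def)
  qed
  have "\<forall>b\<in>a ` {..<k}. u b = 0" if "(\<Sum>b\<in>a ` {..<k}. u b *\<^sub>R b) = 0" for u
    using zero[of "\<lambda>j. u (a j)"] that by (auto simp: sum.reindex[OF inj_a])
  then show "inj_on a {..<k} \<and> independent (a ` {..<k})"
    using inj_a by (auto simp: independent_explicit)
next
  assume ind: "inj_on a {..<k} \<and> independent (a ` {..<k})"
  show "inj_on (lin_map a) (carrier_vec k)"
    unfolding inj_on_lin_map_iff
  proof (intro ballI impI eq_vecI)
    fix x :: "real Matrix.vec" and i
    assume x: "x \<in> carrier_vec k" "lin_map a x = 0" and i: "i < dim_vec (0\<^sub>v k :: real Matrix.vec)"
    define u where "u b = vec_index x (the_inv_into {..<k} a b)" for b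
    have u: "u (a j) = vec_index x j" if "j < k" for j
      using that ind by (simp add: u_def the_inv_into_f_f)
    have "(\<Sum>b\<in>a ` {..<k}. u b *\<^sub>R b) = lin_map a x"
      using ind x(1) by (auto simp: sum.reindex lin_map_def u intro!: sum.cong)
    then have "\<forall>b\<in>a ` {..<k}. u b = 0"
      using ind x(2) by (auto simp: independent_explicit)
    then show "vec_index x i = vec_index (0\<^sub>v k) i" using u i by auto
  qed auto
qed

lemma dim_im_lin_map:
  assumes "inj_on (lin_map a) (carrier_vec k)"
  shows "dim (im_lin_map k a) = k"
  using assms unfolding inj_on_lin_map_iff_independent im_lin_map_eq_span
  by (simp add: dim_eq_card_independent card_image)

text \<open>A kernel vector with a nonzero entry can be rescaled until this entry is
  \<open>pi\<close>. It still acts trivially, yet is not zero on the torus, as \<open>pi\<close> is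
  no integer multiple of \<open>2 * pi\<close>.\<close>

lemma free_torus_action_imp_inj_on:
  assumes "free_torus_action m R"
  shows "inj_on (lin_map R) (carrier_vec m)"
  unfolding inj_on_lin_map_iff
proof (intro ballI impI eq_vecI)
  fix \<phi> :: "real Matrix.vec" and i
  assume \<phi>: "\<phi> \<in> carrier_vec m" "lin_map R \<phi> = 0" and "i < dim_vec (0\<^sub>v m :: real Matrix.vec)"
  then have i: "i < m" by simp
  show "vec_index \<phi> i = vec_index (0\<^sub>v m) i"
  proof (rule ccontr)
    assume "vec_index \<phi> i \<noteq> vec_index (0\<^sub>v m) i"
    then have nz: "vec_index \<phi> i \<noteq> 0" using i by simp
    define c where "c = pi / vec_index \<phi> i"
    have "torus_eq (0 + lin_map R (c \<cdot>\<^sub>v \<phi>)) 0"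
      unfolding lin_map_smult \<phi>(2) torus_eq_def by (auto intro!: exI[of _ 0])
    then have "torus_zero (c \<cdot>\<^sub>v \<phi>)"
      using assms \<phi>(1) unfolding free_torus_action_def by (metis smult_carrier_vec)
    then obtain n :: int where "c * vec_index \<phi> i = 2 * pi * of_int n"
      using i \<phi>(1) unfolding torus_zero_def by auto
    then have "real_of_int (2 * n) = 1" using nz by (simp add: c_def)
    then have "2 * n = 1" by linarith
    then show False by presburger
  qed
qed (auto dest: carrier_vecD)

text \<open>The hypothesis says that the kernel meets the range only in \<open>0\<close>. So
  \<open>A\<close> is injective on its range and, by dimension, maps it onto itself; hence
  \<open>A v\<close> is already the image of some \<open>A w\<close>.\<close>

lemma kernel_range_decomposition:
  fixes A :: "'a::euclidean_space \<Rightarrow> 'a"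
  assumes A: "linear A" and inter: "\<And>v. A (A v) = 0 \<Longrightarrow> A v = 0"
  obtains w where "A (v - A w) = 0"
proof -
  have range: "subspace (range A)" by (rule linear_subspace_image[OF A subspace_UNIV])
  have "inj_on A (range A)"
    unfolding linear_injective_on_subspace_0[OF A range] using inter by auto
  then have "dim (A ` range A) = dim (range A)"
    by (intro dim_image_eq[OF A]) (simp only: span_eq_iff[THEN iffD2, OF range])
  then have "A ` range A = range A"
    by (intro subspace_dim_equal linear_subspace_image A subspace_UNIV) auto
  then obtain w where "A v = A (A w)" by blast
  then show ?thesis using that by (simp add: linear_diff[OF A])
qed

section \<open>Periodic and equivariant fields\<close>

text \<open>Every point has a representative in the compact box with sides \<open>2 * pi\<close>,
  obtained by taking fractional parts.\<close>

lemma periodic_continuous_imp_bounded: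
  fixes H :: "real ^ 'd \<Rightarrow> 'a::real_normed_vector"
  assumes per: "\<forall>x y. torus_eq x y \<longrightarrow> H x = H y" and cont: "continuous_on UNIV H"
  obtains B where "\<And>x. norm (H x) \<le> B"
proof -
  define Q :: "(real ^ 'd) set" where "Q = cbox 0 (\<chi> i. 2 * pi)"
  have "compact (H ` Q)"
    unfolding Q_def by (intro compact_continuous_image compact_cbox continuous_on_subset[OF cont]) simp
  then obtain B where B: "\<And>y. y \<in> H ` Q \<Longrightarrow> norm y \<le> B"
    using compact_imp_bounded bounded_iff by metis
  have "norm (H x) \<le> B" for x
  proof -
    define y :: "real ^ 'd" where "y = (\<chi> i. 2 * pi * frac (x $ i / (2 * pi)))"
    have "y \<in> Q"
      by (auto simp: Q_def y_def mem_box_cart frac_lt_1 less_imp_le)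
    moreover have "torus_eq x y"
      unfolding torus_eq_def y_def frac_def by (auto simp: right_diff_distrib)
    ultimately show ?thesis using per B by (metis imageI)
  qed
  then show ?thesis using that by blast
qed

lemma equivariant_has_derivative:
  fixes H :: "'a::real_normed_vector \<Rightarrow> 'b::real_normed_vector"
  assumes der: "(H has_derivative A) (at p)" and shift: "\<And>x. H (x + v) = H x"
  shows "(H has_derivative A) (at (p + v))"
proof -
  have "H = (\<lambda>x. H (x - v))"
    using shift[of "_ - v"] by auto
  moreover have "((\<lambda>x. H (x - v)) has_derivative A) (at (p + v))"
    by (rule has_derivative_compose[of "\<lambda>x. x - v" "\<lambda>x. x"])
      (auto intro!: derivative_eq_intros der)
  ultimately show ?thesis by simp
qed

text \<open>\<open>H\<close> is constant on the line through \<open>p\<close> in direction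
  \<open>v\<close>, so its directional derivative there is \<open>0\<close>.\<close>

lemma equivariant_derivative_eq_0:
  fixes H :: "'a::real_normed_vector \<Rightarrow> 'b::real_normed_vector"
  assumes der: "(H has_derivative A) (at p)" and shift: "\<And>s. H (p + s *\<^sub>R v) = H p"
  shows "A v = 0"
proof -
  have "((\<lambda>s. p + s *\<^sub>R v) has_derivative (\<lambda>s. s *\<^sub>R v)) (at 0)"
    by (auto intro!: derivative_eq_intros)
  then have "((\<lambda>s. H (p + s *\<^sub>R v)) has_derivative (\<lambda>s. A (s *\<^sub>R v))) (at (0::real))"
    using has_derivative_compose[of "\<lambda>s. p + s *\<^sub>R v" _ 0 UNIV H A] der by simp
  then have "((\<lambda>s::real. H p) has_derivative (\<lambda>s. A (s *\<^sub>R v))) (at 0)"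
    using shift by simp
  then have "(\<lambda>s::real. A (s *\<^sub>R v)) = (\<lambda>s. 0)"
    using has_derivative_unique has_derivative_const by blast
  from fun_cong[OF this, of 1] show ?thesis by simp
qed

section \<open>Growth rates and normal hyperbolicity\<close>

text \<open>A nonzero \<open>c\<close> would grow at least like \<open>exp (\<nu> * t) / C\<close>,
  whereas \<open>v\<close>, \<open>a\<close> and \<open>b\<close> together allow only linear growth.
  It is stated for a general family \<open>S\<close> so that it serves in both time directions, with
  stable and unstable parts exchanged.\<close>

lemma expanding_component_eq_0:
  fixes S :: "real \<Rightarrow> 'a::real_normed_vector \<Rightarrow> 'a"
  assumes "0 < \<nu>" "0 < C"
    and split: "\<And>t. 0 \<le> t \<Longrightarrow> S t v = S t a + S t b + S t c"
    and v: "\<And>t. 0 \<le> t \<Longrightarrow> norm (S t v) \<le> K * (1 + t)"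
    and a: "\<And>t. 0 \<le> t \<Longrightarrow> norm (S t a) \<le> norm a"
    and b: "\<And>t. 0 \<le> t \<Longrightarrow> norm (S t b) \<le> C * exp (- \<nu> * t) * norm b"
    and c: "\<And>t. 0 \<le> t \<Longrightarrow> norm c \<le> C * exp (- \<nu> * t) * norm (S t c)"
  shows "c = 0"
proof -
  \<comment> \<open>The bound for \<open>norm c\<close> that results from inserting the triangle
    inequality for \<open>S t c\<close> into assumption \<open>c\<close>.\<close>
  define g where "g t = C * exp (- \<nu> * t) * (K * (1 + t) + norm a + C * norm b)" for t
  have "(g \<longlongrightarrow> 0) at_top"
    unfolding g_def using \<open>0 < \<nu>\<close> by real_asymp
  moreover have "norm c \<le> g t" if t: "0 \<le> t" for t
  proof -
    have "exp (- \<nu> * t) \<le> 1" using t \<open>0 < \<nu>\<close> by simp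
    then have "C * exp (- \<nu> * t) * norm b \<le> C * norm b"
      using \<open>0 < C\<close> by (simp add: mult_left_le mult_right_mono)
    moreover have "norm (S t c) \<le> norm (S t v) + norm (S t a) + norm (S t b)"
    proof -
      have "S t c = S t v - S t a - S t b" using split[OF t] by simp
      then show ?thesis
        using norm_triangle_ineq4[of "S t v - S t a" "S t b"] norm_triangle_ineq4[of "S t v" "S t a"]
        by simp
    qed
    ultimately have "norm (S t c) \<le> K * (1 + t) + norm a + C * norm b"
      using v[OF t] a[OF t] b[OF t] by linarith
    then have "C * exp (- \<nu> * t) * norm (S t c) \<le> g t"
      unfolding g_def using \<open>0 < C\<close> by (intro mult_left_mono) auto
    then show ?thesis using c[OF t] by linarith
  qed
  ultimately have "norm c \<le> 0"
    by (intro tendsto_lowerbound[of g 0 at_top])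
      (auto intro!: eventually_at_top_linorderI[of 0] simp: trivial_limit_at_top_linorder)
  then show ?thesis by simp
qed

text \<open>Split \<open>v\<close> at \<open>p\<close> into tangential, stable and unstable parts.
  The tangential part is fixed by the linear flow, forward time excludes the unstable part and
  backward time the stable one. The derivative of the flow must be known along the whole orbit of
  \<open>p\<close>, since lower growth bounds come from decay estimates that start at
  \<open>\<Phi> t p\<close>.\<close>

lemma normally_hyperbolic_linear_growth_imp_tangent:
  fixes H :: "real ^ 'd \<Rightarrow> real ^ 'd"
  assumes nh: "normally_hyperbolic H M (\<lambda>_. V)" and p: "p \<in> M"
    and A: "bounded_linear A" and V: "\<And>v. v \<in> V \<Longrightarrow> A v = 0"
    and lin: "\<And>\<Phi> s t. is_flow H \<Phi> \<Longrightarrow> frechet_derivative (\<Phi> t) (at (\<Phi> s p)) = lin_flow A t"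
    and growth: "\<And>t. norm (lin_flow A t v) \<le> K * (1 + \<bar>t\<bar>)"
  shows "v \<in> V"
proof -
  obtain \<Phi> Es Eu C \<mu> \<nu> where flow: "is_flow H \<Phi>" and inv: "\<forall>t. \<forall>p\<in>M. \<Phi> t p \<in> M"
    and sum: "\<forall>p\<in>M. direct_sum3 V (Es p) (Eu p)"
    and invs: "invariant_bundle \<Phi> M Es" and invu: "invariant_bundle \<Phi> M Eu"
    and const: "C > 0" "0 \<le> \<mu>" "\<mu> < \<nu>"
    and s: "\<forall>p\<in>M. \<forall>t\<ge>0. \<forall>v\<in>Es p.
        norm (frechet_derivative (\<Phi> t) (at p) v) \<le> C * exp (- \<nu> * t) * norm v"
    and u: "\<forall>p\<in>M. \<forall>t\<le>0. \<forall>v\<in>Eu p.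
        norm (frechet_derivative (\<Phi> t) (at p) v) \<le> C * exp (\<nu> * t) * norm v"
    using nh unfolding normally_hyperbolic_def by (elim exE conjE) (rule that)
  note s = s[rule_format] and u = u[rule_format]
  have "0 < \<nu>" using const by simp
  obtain a b c where abc: "a \<in> V" "b \<in> Es p" "c \<in> Eu p" "v = a + b + c"
    using bspec[OF sum p, unfolded direct_sum3_def]
    by (elim conjE allE[of _ v]) (drule ex1_implies_ex, auto)
  note lin' = lin[OF flow]
  have lin0: "frechet_derivative (\<Phi> t) (at p) = lin_flow A t" for t
    using lin'[of t 0] flow unfolding is_flow_def by simp
  have M: "\<Phi> t p \<in> M" for t using inv p by blast
  have bE: "lin_flow A t b \<in> Es (\<Phi> t p)" and cE: "lin_flow A t c \<in> Eu (\<Phi> t p)" for t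
    using invs invu p abc lin0 unfolding invariant_bundle_def by (metis imageI)+
  interpret P: bounded_linear "lin_flow A t" for t
    using bounded_linear_lin_flow[OF A] .
  have split: "lin_flow A t v = lin_flow A t a + lin_flow A t b + lin_flow A t c" for t
    unfolding abc(4) by (simp add: P.add)
  have a: "lin_flow A t a = a" for t using lin_flow_kernel[OF A V] abc(1) by blast
  have "c = 0"
  proof (rule expanding_component_eq_0[where S = "lin_flow A" and v = v and a = a and b = b])
    fix t :: real assume t: "0 \<le> t"
    show "norm (lin_flow A t v) \<le> K * (1 + t)" using growth[of t] t by simp
    show "norm (lin_flow A t b) \<le> C * exp (- \<nu> * t) * norm b"
      using s[OF p t abc(2)] by (simp add: lin0)
    \<comment> \<open>The backward decay on \<open>Eu\<close> is applied at
      \<open>\<Phi> t p\<close> for time \<open>- t\<close>, which returns the transported vector to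
      \<open>c\<close>.\<close>
    show "norm c \<le> C * exp (- \<nu> * t) * norm (lin_flow A t c)"
      using u[OF M _ cE, of "- t" t] t by (simp add: lin' lin_flow_minus[OF A])
  qed (use \<open>0 < \<nu>\<close> const split a in auto)
  moreover have "b = 0"
  proof (rule expanding_component_eq_0[where S = "\<lambda>t. lin_flow A (- t)" and v = v and a = a and b = c])
    fix t :: real assume t: "0 \<le> t"
    show "lin_flow A (- t) v = lin_flow A (- t) a + lin_flow A (- t) c + lin_flow A (- t) b"
      by (simp add: split)
    show "norm (lin_flow A (- t) v) \<le> K * (1 + t)" using growth[of "- t"] t by simp
    show "norm (lin_flow A (- t) c) \<le> C * exp (- \<nu> * t) * norm c"
      using u[OF p _ abc(3), of "- t"] t by (simp add: lin0)
    \<comment> \<open>Here the forward decay on \<open>Es\<close> starts at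
      \<open>\<Phi> (- t) p\<close> and brings the transported vector back to
      \<open>b\<close>.\<close>
    show "norm b \<le> C * exp (- \<nu> * t) * norm (lin_flow A (- t) b)"
      using s[OF M t bE, of "- t"] lin_flow_minus[OF A, of "- t" b] by (simp add: lin')
  qed (use \<open>0 < \<nu>\<close> const a in auto)
  ultimately show ?thesis using abc by simp
qed

section \<open>The matrix on an invariant complement and its eigenvalues\<close>

lemma lin_map_matrix_exists:
  assumes A: "linear A" and inv: "\<And>j. j < k \<Longrightarrow> A (N j) \<in> im_lin_map k N"
  obtains L where "L \<in> carrier_mat k k"
    "\<And>x. x \<in> carrier_vec k \<Longrightarrow> A (lin_map N x) = lin_map N (L *\<^sub>v x)"
proof -
  have "\<forall>j. \<exists>l. j < k \<longrightarrow> l \<in> carrier_vec k \<and> A (N j) = lin_map N l"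
    using inv unfolding im_lin_map_def by blast
  then obtain l where l: "\<And>j. j < k \<Longrightarrow> l j \<in> carrier_vec k \<and> A (N j) = lin_map N (l j)"
    by metis
  \<comment> \<open>Column \<open>j\<close> holds coordinates of \<open>A (N j)\<close> with respect
    to \<open>N\<close>.\<close>
  define L where "L = Matrix.mat k k (\<lambda>(i, j). vec_index (l j) i)"
  have "A (lin_map N x) = lin_map N (L *\<^sub>v x)" if x: "x \<in> carrier_vec k" for x
  proof -
    have "A (lin_map N x) = (\<Sum>j<k. vec_index x j *\<^sub>R (\<Sum>i<k. vec_index (l j) i *\<^sub>R N i))"
      using x l by (auto simp: lin_map_def linear_sum[OF A] linear_cmul[OF A] intro!: sum.cong)
    also have "\<dots> = (\<Sum>i<k. (\<Sum>j<k. vec_index (l j) i * vec_index x j) *\<^sub>R N i)"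
      by (simp add: scaleR_sum_right scaleR_sum_left mult.commute) (rule sum.swap)
    also have "\<dots> = lin_map N (L *\<^sub>v x)"
      using x by (auto simp: lin_map_def L_def scalar_prod_def lessThan_atLeast0 intro!: sum.cong)
    finally show ?thesis .
  qed
  then show ?thesis using that[of L] by (simp add: L_def)
qed

text \<open>Since \<open>L\<close> is real, the eigenvalue equation splits into real and imaginary
  parts. One of the two vectors may vanish when \<open>\<mu> = 0\<close>, so only their simultaneous
  vanishing is excluded.\<close>

lemma eigenvalue_imaginary_real_parts:
  fixes L :: "real mat"
  assumes L: "L \<in> carrier_mat k k"
    and ev: "eigenvalue (map_mat complex_of_real L) \<mu>" and Re: "Re \<mu> = 0"
  obtains u w where "u \<in> carrier_vec k" "w \<in> carrier_vec k" "\<not> (u = 0\<^sub>v k \<and> w = 0\<^sub>v k)"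
    "L *\<^sub>v u = (- Im \<mu>) \<cdot>\<^sub>v w" "L *\<^sub>v w = Im \<mu> \<cdot>\<^sub>v u"
proof -
  obtain x where x: "x \<in> carrier_vec k" "x \<noteq> 0\<^sub>v k" and eq: "map_mat complex_of_real L *\<^sub>v x = \<mu> \<cdot>\<^sub>v x"
    using ev L unfolding eigenvalue_def eigenvector_def by auto
  have i: "(\<Sum>j<k. complex_of_real (L $$ (i, j)) * vec_index x j) = \<mu> * vec_index x i" if "i < k" for i
    using arg_cong[OF eq, of "\<lambda>v. vec_index v i"] that x L
    by (simp add: scalar_prod_def lessThan_atLeast0)
  have "L *\<^sub>v map_vec Re x = (- Im \<mu>) \<cdot>\<^sub>v map_vec Im x"
    using x L by (intro eq_vecI)
      (auto simp: scalar_prod_def lessThan_atLeast0[symmetric] Re dest!: arg_cong[OF i, of _ Re])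
  moreover have "L *\<^sub>v map_vec Im x = Im \<mu> \<cdot>\<^sub>v map_vec Re x"
    using x L by (intro eq_vecI)
      (auto simp: scalar_prod_def lessThan_atLeast0[symmetric] Re dest!: arg_cong[OF i, of _ Im])
  moreover have "\<not> (map_vec Re x = 0\<^sub>v k \<and> map_vec Im x = 0\<^sub>v k)"
  proof
    assume 0: "map_vec Re x = 0\<^sub>v k \<and> map_vec Im x = 0\<^sub>v k"
    have "vec_index x i = 0" if "i < k" for i
      using arg_cong[OF conjunct1[OF 0], of "\<lambda>v. vec_index v i"]
        arg_cong[OF conjunct2[OF 0], of "\<lambda>v. vec_index v i"] that x
      by (simp add: complex_eq_iff)
    then have "x = 0\<^sub>v k" using x by (intro eq_vecI) auto
    then show False using x by simp
  qed
  ultimately show ?thesis using that x(1) by (metis map_carrier_vec)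
qed

lemma direct_sum2I:
  assumes S: "subspace S" and T: "subspace T" and inter: "S \<inter> T = {0}"
    and sum: "\<And>v. \<exists>a\<in>S. \<exists>b\<in>T. v = a + b"
  shows "direct_sum2 S T"
  unfolding direct_sum2_def
proof (intro conjI S T allI)
  fix v
  obtain a b where ab: "a \<in> S" "b \<in> T" "v = a + b" using sum by metis
  show "\<exists>!(a, b). a \<in> S \<and> b \<in> T \<and> v = a + b"
  proof (intro ex1I[of _ "(a, b)"])
    fix q assume "case q of (a, b) \<Rightarrow> a \<in> S \<and> b \<in> T \<and> v = a + b"
    then obtain a' b' where q: "q = (a', b')" "a' \<in> S" "b' \<in> T" "v = a' + b'" by auto
    have eq: "a - a' = b' - b" using ab(3) q(4) by (simp add: algebra_simps)
    have "a - a' \<in> S \<inter> T"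
      using subspace_diff[OF S ab(1) q(2)] subspace_diff[OF T q(3) ab(2)] unfolding eq by simp
    then have "a - a' = 0" "b' - b = 0" unfolding inter eq by simp_all
    then show "q = (a, b)" using q by simp
  qed (use ab in auto)
qed

theorem proposition2p4:
  fixes m :: nat
    and R :: "nat \<Rightarrow> real ^ 'd"
    and H :: "real ^ 'd \<Rightarrow> real ^ 'd"
    and \<theta>\<^sub>0 :: "real ^ 'd"
    and \<Omega> :: "real Matrix.vec"
  assumes R_int: "\<forall>j<m. \<forall>i. R j $ i \<in> \<int>"
    and free: "free_torus_action m R"
    and H_periodic: "\<forall>x y. torus_eq x y \<longrightarrow> H x = H y"
    and H_C1: "C1_field H"
    and H_equivariant: "\<forall>\<theta>. \<forall>\<phi> \<in> carrier_vec m. H (\<theta> + lin_map R \<phi>) = H \<theta>"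
    and Omega: "\<Omega> \<in> carrier_vec m" "H \<theta>\<^sub>0 = lin_map R \<Omega>"
    and nh: "normally_hyperbolic H (rel_eq_torus m \<theta>\<^sub>0 R) (\<lambda>p. im_lin_map m R)"
  shows "\<exists>(N :: nat \<Rightarrow> real ^ 'd) (L :: real mat).
           inj_on (lin_map N) (carrier_vec (CARD('d) - m)) \<and>
           L \<in> carrier_mat (CARD('d) - m) (CARD('d) - m) \<and> hyperbolic_mat L \<and>
           direct_sum2 (im_lin_map m R) (im_lin_map (CARD('d) - m) N) \<and>
           (\<forall>\<phi> \<in> carrier_vec m. \<forall>x \<in> carrier_vec (CARD('d) - m).
              frechet_derivative H (at (rel_eq_emb \<theta>\<^sub>0 R \<phi>)) (lin_map N x) = lin_map N (L *\<^sub>v x))"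
proof -
  define V where "V = im_lin_map m R"
  define n where "n = CARD('d) - m"
  have V: "subspace V" unfolding V_def im_lin_map_eq_span by simp
  have shift: "H (x + v) = H x" if "v \<in> V" for x v
    using H_equivariant that unfolding V_def im_lin_map_def by auto
  have "H differentiable (at x)" for x
    using H_C1 unfolding C1_field_def differentiable_def by blast
  then have diff: "(H has_derivative frechet_derivative H (at x)) (at x)" for x
    by (simp add: frechet_derivative_works)
  then have "continuous_on UNIV H"
    by (auto simp: continuous_on_eq_continuous_at intro: has_derivative_continuous)
  then obtain B where B: "\<And>x. norm (H x) \<le> B"
    using periodic_continuous_imp_bounded[OF H_periodic] by blast
  define A where "A = frechet_derivative H (at \<theta>\<^sub>0)"
  have der: "(H has_derivative A) (at (\<theta>\<^sub>0 + v))" if "v \<in> V" for v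
    using equivariant_has_derivative[OF diff shift[OF that], of \<theta>\<^sub>0] by (simp add: A_def)
  have A: "bounded_linear A" using diff[of \<theta>\<^sub>0] by (simp add: A_def has_derivative_bounded_linear)
  then have lin_A: "linear A" by (rule bounded_linear.linear)
  have AV: "A v = 0" if "v \<in> V" for v
  proof (rule equivariant_derivative_eq_0[OF diff[of \<theta>\<^sub>0, folded A_def]])
    show "H (\<theta>\<^sub>0 + s *\<^sub>R v) = H \<theta>\<^sub>0" for s by (rule shift) (use V that in \<open>auto intro: subspace_scale\<close>)
  qed
  have H\<theta>: "H (\<theta>\<^sub>0 + v) \<in> V" if "v \<in> V" for v
    using shift[OF that] Omega unfolding V_def im_lin_map_def by simp
  \<comment> \<open>At points of the sheet \<open>\<theta>\<^sub>0 + V\<close> the field takes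
    values in \<open>V\<close>, so equivariance includes invariance under shifts along the field
    itself, as the comoving frame requires.\<close>
  have flow: "\<Phi> t (\<theta>\<^sub>0 + v) = \<theta>\<^sub>0 + v + t *\<^sub>R H (\<theta>\<^sub>0 + v)"
    "frechet_derivative (\<Phi> t) (at (\<theta>\<^sub>0 + v)) = lin_flow A t"
    if \<Phi>: "is_flow H \<Phi>" and v: "v \<in> V" for \<Phi> t v
  proof -
    have sh: "H (x + s *\<^sub>R H (\<theta>\<^sub>0 + v)) = H x" for s x
      by (rule shift) (use V H\<theta>[OF v] in \<open>auto intro: subspace_scale\<close>)
    note fl = flow_relative_equilibrium[OF der[OF v] B sh, of \<Phi> t]
    show "\<Phi> t (\<theta>\<^sub>0 + v) = \<theta>\<^sub>0 + v + t *\<^sub>R H (\<theta>\<^sub>0 + v)"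
      using fl(1) \<Phi> unfolding is_flow_def by blast
    show "frechet_derivative (\<Phi> t) (at (\<theta>\<^sub>0 + v)) = lin_flow A t"
      using fl(2) \<Phi> unfolding is_flow_def by (metis frechet_derivative_at)
  qed
  \<comment> \<open>All information from normal hyperbolicity enters here, through the orbit of the
    single point \<open>\<theta>\<^sub>0\<close>, which stays in the sheet
    \<open>\<theta>\<^sub>0 + V\<close>.\<close>
  have growth_V: "v \<in> V" if "\<And>t. norm (lin_flow A t v) \<le> K * (1 + \<bar>t\<bar>)" for v K
  proof (rule normally_hyperbolic_linear_growth_imp_tangent[OF nh[folded V_def] _ A AV _ that])
    have "lin_map R (0\<^sub>v m) = 0" by (simp add: lin_map_def)
    then show "\<theta>\<^sub>0 \<in> rel_eq_torus m \<theta>\<^sub>0 R"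
      unfolding rel_eq_torus_def rel_eq_emb_def torus_eq_def
      by (auto intro!: bexI[of _ "0\<^sub>v m"] exI[of _ 0])
    fix \<Phi> s t assume \<Phi>: "is_flow H \<Phi>"
    have "s *\<^sub>R H \<theta>\<^sub>0 \<in> V" using H\<theta>[of 0] V by (auto intro: subspace_scale subspace_0)
    moreover have "\<Phi> s \<theta>\<^sub>0 = \<theta>\<^sub>0 + s *\<^sub>R H \<theta>\<^sub>0"
      using flow(1)[OF \<Phi>, of 0 s] subspace_0[OF V] by simp
    ultimately show "frechet_derivative (\<Phi> t) (at (\<Phi> s \<theta>\<^sub>0)) = lin_flow A t"
      using flow(2)[OF \<Phi>] by simp
  qed
  \<comment> \<open>This serves twice: it identifies the kernel of \<open>A\<close> with
    \<open>V\<close>, and it excludes a nilpotent part of \<open>A\<close> over the eigenvalue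
    \<open>0\<close>.\<close>
  have ker_square: "v \<in> V" if "A (A v) = 0" for v
  proof (rule growth_V)
    fix t
    have "norm (lin_flow A t v) \<le> norm v + \<bar>t\<bar> * norm (A v)"
      using norm_triangle_ineq[of v "t *\<^sub>R A v"] by (simp add: lin_flow_kernel_square[OF A that])
    also have "\<dots> \<le> (norm v + norm (A v)) * (1 + \<bar>t\<bar>)" by (simp add: algebra_simps)
    finally show "norm (lin_flow A t v) \<le> (norm v + norm (A v)) * (1 + \<bar>t\<bar>)" .
  qed
  have ker: "v \<in> V" if "A v = 0" for v
    using ker_square[of v] that linear_0[OF lin_A] by simp
  have rotation: "v \<in> V" if "A v = - (\<omega> *\<^sub>R w)" "A w = \<omega> *\<^sub>R v" for v w \<omega>
  proof (rule growth_V)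
    fix t
    have "norm (lin_flow A t v) \<le> \<bar>cos (\<omega> * t)\<bar> * norm v + \<bar>sin (\<omega> * t)\<bar> * norm w"
      using norm_triangle_ineq4[of "cos (\<omega> * t) *\<^sub>R v" "sin (\<omega> * t) *\<^sub>R w"]
      by (simp add: lin_flow_rotation[OF A that])
    also have "\<dots> \<le> 1 * norm v + 1 * norm w"
      by (intro add_mono mult_right_mono) auto
    also have "\<dots> \<le> (norm v + norm w) * (1 + \<bar>t\<bar>)" by (simp add: algebra_simps)
    finally show "norm (lin_flow A t v) \<le> (norm v + norm w) * (1 + \<bar>t\<bar>)" .
  qed
  have range_A: "subspace (range A)" by (rule linear_subspace_image[OF lin_A subspace_UNIV])
  \<comment> \<open>If \<open>x = A y\<close> lies in \<open>V\<close>, then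
    \<open>A (A y) = 0\<close>, so \<open>y\<close> itself lies in \<open>V\<close> and
    \<open>A y = 0\<close>.\<close>
  have inter_eq_0: "x = 0" if x: "x \<in> V" "x \<in> range A" for x
  proof -
    obtain y where y: "x = A y" using x(2) by blast
    then have "y \<in> V" using AV[OF x(1)] by (intro ker_square) simp
    then show ?thesis unfolding y by (rule AV)
  qed
  then have inter: "V \<inter> range A = {0}"
    using subspace_0[OF V] subspace_0[OF range_A] by (intro equalityI subsetI) auto
  have sum: "\<exists>a\<in>V. \<exists>b\<in>range A. v = a + b" for v
  proof -
    obtain w where "A (v - A w) = 0"
      using kernel_range_decomposition[OF lin_A, of v] ker_square AV by metis
    then have "v - A w \<in> V" by (rule ker)
    then show ?thesis by (metis diff_add_cancel rangeI)
  qed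
  have "{x + y |x y. x \<in> V \<and> y \<in> range A} = UNIV" using sum by blast
  then have "dim V + dim (range A) = CARD('d)"
    using dim_sums_Int[OF V range_A] by (simp add: inter)
  \<comment> \<open>Since \<open>dim V = m\<close>, the sum of dimensions gives
    \<open>m \<le> CARD('d)\<close>, so the natural subtraction in \<open>n\<close> is the true
    difference.\<close>
  then have dim: "dim (range A) = n"
    using dim_im_lin_map[OF free_torus_action_imp_inj_on[OF free]] by (simp add: V_def n_def)
  obtain S where S: "S \<subseteq> range A" "independent S" "range A \<subseteq> span S" "card S = n"
    using basis_exists[of "range A"] dim by metis
  then obtain N where N: "bij_betw N {..<n} S"
    using ex_bij_betw_nat_finite[OF independent_imp_finite] by (metis lessThan_atLeast0)
  have im_N: "im_lin_map n N = range A"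
    unfolding im_lin_map_eq_span bij_betw_imp_surj_on[OF N]
    using S range_A by (intro equalityI span_minimal) auto
  have inj_N: "inj_on (lin_map N) (carrier_vec n)"
    unfolding inj_on_lin_map_iff_independent
    using N S(2) by (simp add: bij_betw_def)
  have "A (N j) \<in> im_lin_map n N" for j unfolding im_N by simp
  then obtain L where L: "L \<in> carrier_mat n n"
    "\<And>x. x \<in> carrier_vec n \<Longrightarrow> A (lin_map N x) = lin_map N (L *\<^sub>v x)"
    using lin_map_matrix_exists[OF lin_A] by metis
  have "hyperbolic_mat L"
    unfolding hyperbolic_mat_def
  proof (intro allI impI notI)
    fix \<mu> assume "eigenvalue (map_mat complex_of_real L) \<mu>" "Re \<mu> = 0"
    then obtain u w where uw: "u \<in> carrier_vec n" "w \<in> carrier_vec n"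
      "\<not> (u = 0\<^sub>v n \<and> w = 0\<^sub>v n)"
      "L *\<^sub>v u = (- Im \<mu>) \<cdot>\<^sub>v w" "L *\<^sub>v w = Im \<mu> \<cdot>\<^sub>v u"
      using eigenvalue_imaginary_real_parts[OF L(1)] by metis
    have Au: "A (lin_map N u) = - (Im \<mu> *\<^sub>R lin_map N w)"
      and Aw: "A (lin_map N w) = Im \<mu> *\<^sub>R lin_map N u"
      using uw by (simp_all add: L(2) lin_map_smult)
    have "lin_map N u \<in> V" by (rule rotation[OF Au Aw])
    \<comment> \<open>The pair \<open>(w, u)\<close> satisfies the same equations with the frequency
      negated.\<close>
    moreover have "lin_map N w \<in> V"
      using rotation[of "lin_map N w" "- Im \<mu>" "lin_map N u"] Au Aw by simp
    moreover have "lin_map N u \<in> range A" "lin_map N w \<in> range A"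
      using uw im_N unfolding im_lin_map_def by blast+
    ultimately have "lin_map N u = 0" "lin_map N w = 0" by (simp_all add: inter_eq_0)
    then show False using inj_N uw unfolding inj_on_lin_map_iff by blast
  qed
  moreover have "direct_sum2 (im_lin_map m R) (im_lin_map n N)"
    unfolding im_N V_def[symmetric] by (rule direct_sum2I[OF V range_A inter sum])
  \<comment> \<open>By equivariance the derivative at every point of the sheet is \<open>A\<close>,
    so one \<open>L\<close> serves all \<open>\<phi>\<close>.\<close>
  moreover have "frechet_derivative H (at (rel_eq_emb \<theta>\<^sub>0 R \<phi>)) (lin_map N x) = lin_map N (L *\<^sub>v x)"
    if "\<phi> \<in> carrier_vec m" "x \<in> carrier_vec n" for \<phi> x
    using frechet_derivative_at[OF der[of "lin_map R \<phi>"]] that L(2)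
    by (simp add: rel_eq_emb_def V_def im_lin_map_def)
  ultimately show ?thesis using inj_N L(1) unfolding n_def[symmetric] by blast
qed

end
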